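(* Let $V$ be the set of integer points $(x,y,z)\in\mathbb{Z}^3$ such that none of $x+y,\ x-y,\ y+z,\ y-z,\ z+x,\ z-x$ is congruent to $0 \pmod 4$, and let $G$ be the graph (the sodalite network) with vertex set $V$ in which two vertices are adjacent exactly when their Euclidean distance is $\sqrt{2}$. Let $O=(0,1,2)$ and, for $P\in V$, let $\operatorname{dis}(P)$ denote the graph distance in $G$ from $O$ to $P$. Define $h:V\to\mathbb{R}$ as follows. For $P=(x,y,z)\in V$ let $x'\ge y'\ge z'\ge 0$ be the absolute values $|x|,|y|,|z|$ sorted in decreasing order, and put $$h'(P)=x'+\tfrac{y'}{2}-\tfrac{s}{2},\qquad s=a(y' \bmod 4)\cdot b(x' \bmod 4),$$ where $(a(0),a(1),a(2),a(3))=(0,1,0,-1)$ and $(b(0),b(1),b(2),b(3))=(1,0,-1,0)$. Then $h(P)=h'(P)+c(P)$, where, writing $\operatorname{sig}$ for the sign function, $c(P)=0$ if $|x|\ge|y|\ge|z|$; $c(P)=-\operatorname{sig}(z)$ if $|x|\ge|z|\ge|y|$; $c(P)=-\operatorname{sig}(y)$ if $|y|\ge|x|\ge|z|$; $c(P)=0$ if $|y|\ge|z|\ge|x|$ and $yz\le 0$; $c(P)=-2\operatorname{sig}(z)$ if $|y|\ge|z|\ge|x|$ and $yz\ge 0$; $c(P)=-2\operatorname{sig}(z)$ if $|z|\ge|x|\ge|y|$; $c(P)=-\operatorname{sig}(z)$ if $|z|\ge|y|\ge|x|$ and $yz\le 0$; $c(P)=-3\operatorname{sig}(y)$ if $|z|\ge|y|\ge|x|$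 and $yz\ge 0$. Then $\operatorname{dis}(P)=h(P)$ for every $P\in V$.
   Context: $G$ is the edge-skeleton of the uniform tiling of Euclidean 3-space by truncated octahedra, scaled by a factor 4 so that vertices have integer coordinates; each vertex has exactly four neighbours (e.g. the neighbours of $(0,1,2)$ are $(0,2,1),(0,2,3),(1,0,2),(-1,0,2)$). For vertices in $V$ the absolute values $|x|,|y|,|z|$ are pairwise distinct, so exactly one case of the definition of $c(P)$ applies and the relevant signs are of nonzero coordinates. *)

theory Defs
  imports Complex_Main "HOL-Library.Extended_Nat"
begin

type_synonym pt = "int \<times> int \<times> int"

definition inV :: "pt \<Rightarrow> bool" where
  "inV P = (case P of (x, y, z) \<Rightarrow>
     \<not> (4 dvd (x + y)) \<and> \<not> (4 dvd (x - y)) \<and> \<not> (4 dvd (y + z)) \<and>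
     \<not> (4 dvd (y - z)) \<and> \<not> (4 dvd (z + x)) \<and> \<not> (4 dvd (z - x)))"

definition sqdist :: "pt \<Rightarrow> pt \<Rightarrow> int" where
  "sqdist P Q = (case P of (x1, y1, z1) \<Rightarrow> case Q of (x2, y2, z2) \<Rightarrow>
     (x1 - x2)^2 + (y1 - y2)^2 + (z1 - z2)^2)"

definition adjG :: "pt \<Rightarrow> pt \<Rightarrow> bool" where
  "adjG P Q = (inV P \<and> inV Q \<and> sqdist P Q = 2)"

definition O_pt :: pt where "O_pt = (0, 1, 2)"

text \<open>Graph distance from O (infinity if unreachable): least length of a walk.\<close>
definition dis :: "pt \<Rightarrow> enat" where
  "dis P = (INF n \<in> {n :: nat. (adjG ^^ n) O_pt P}. enat n)"

definition a_fun :: "int \<Rightarrow> int" where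
  "a_fun r = (if r = 1 then 1 else if r = 3 then -1 else 0)"

definition b_fun :: "int \<Rightarrow> int" where
  "b_fun r = (if r = 0 then 1 else if r = 2 then -1 else 0)"

definition h' :: "pt \<Rightarrow> real" where
  "h' P = (case P of (x, y, z) \<Rightarrow>
     let x' = max \<bar>x\<bar> (max \<bar>y\<bar> \<bar>z\<bar>);
         z' = min \<bar>x\<bar> (min \<bar>y\<bar> \<bar>z\<bar>);
         y' = \<bar>x\<bar> + \<bar>y\<bar> + \<bar>z\<bar> - x' - z';
         s = a_fun (y' mod 4) * b_fun (x' mod 4)
     in real_of_int x' + real_of_int y' / 2 - real_of_int s / 2)"

definition c_fun :: "pt \<Rightarrow> real" where
  "c_fun P = (case P of (x, y, z) \<Rightarrow> real_of_int (
     if \<bar>x\<bar> \<ge> \<bar>y\<bar> \<and> \<bar>y\<bar> \<ge> \<bar>z\<bar> then 0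
     else if \<bar>x\<bar> \<ge> \<bar>z\<bar> \<and> \<bar>z\<bar> \<ge> \<bar>y\<bar> then - sgn z
     else if \<bar>y\<bar> \<ge> \<bar>x\<bar> \<and> \<bar>x\<bar> \<ge> \<bar>z\<bar> then - sgn y
     else if \<bar>y\<bar> \<ge> \<bar>z\<bar> \<and> \<bar>z\<bar> \<ge> \<bar>x\<bar> then (if y * z \<le> 0 then 0 else - 2 * sgn z)
     else if \<bar>z\<bar> \<ge> \<bar>x\<bar> \<and> \<bar>x\<bar> \<ge> \<bar>y\<bar> then - 2 * sgn z
     else (if y * z \<le> 0 then - sgn z else - 3 * sgn y)))"

definition h :: "pt \<Rightarrow> real" where
  "h P = h' P + c_fun P"

end

theory Submission
  imports Defs
begin

text \<open>
  The planes \<open>u + v \<in> 4\<int>\<close> and \<open>u - v \<in> 4\<int>\<close>, for \<open>u, v\<close> two of the three coordinates, are the mirrors of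
  the affine Weyl group of type \<open>A\<^sub>3\<close>. Each alcove contains exactly one point of \<open>V\<close>, and the edges of
  \<open>G\<close> join points in alcoves that share a wall. So the distance from \<open>O\<close> to \<open>P\<close> is the number of mirrors
  separating them. The six forms \<open>y \<plusminus> x, z \<plusminus> y, z \<plusminus> x\<close> all take values strictly between 0 and 4 at
  \<open>O\<close>, so this number is the sum of \<open>\<bar>\<lfloor>\<alpha>(P)/4\<rfloor>\<bar>\<close> over these forms \<open>\<alpha>\<close>, which turns out to be \<open>h(P)\<close>.
\<close>

section \<open>The formula for h as a count of mirrors\<close>

text \<open>The order of the arguments matters: \<open>v\<close> is the coordinate that is larger at
  O, so both quotients vanish at O and their absolute values count the mirrors crossed.\<close>

definition pair_cross :: "int \<Rightarrow> int \<Rightarrow> int" where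
  "pair_cross u v = \<bar>(v - u) div 4\<bar> + \<bar>(v + u) div 4\<bar>"

fun walls :: "pt \<Rightarrow> int" where
  "walls (x, y, z) = pair_cross x y + pair_cross y z + pair_cross x z"

text \<open>Negation modulo 4 fixes 0 and 2 and swaps 1 and 3, so \<open>a_fun\<close> is odd and
  \<open>b_fun\<close> is even.\<close>

lemma a_fun_abs: "a_fun (\<bar>y\<bar> mod 4) = a_fun (y mod 4) * sgn y"
  unfolding a_fun_def abs_if sgn_if by (auto; presburger)

lemma b_fun_abs: "b_fun (\<bar>y\<bar> mod 4) = b_fun (y mod 4)"
  unfolding b_fun_def abs_if by (auto; presburger)

text \<open>The term \<open>s\<close> of \<open>h'\<close> for \<open>y' = \<bar>u\<bar>\<close> and \<open>x' = \<bar>v\<bar>\<close>.\<close>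

definition corr :: "int \<Rightarrow> int \<Rightarrow> int" where
  "corr u v = a_fun (u mod 4) * b_fun (v mod 4) * sgn u"

text \<open>Each quotient is a form minus its residue, divided by 4. If \<open>|u| < |v|\<close>,
  both forms have the sign of \<open>v\<close> and their residues add up to 4, with an error of 0 or
  2 either way; the 4 yields \<open>- 2 * sgn v\<close>. If \<open>|v| < |u|\<close>, the forms have
  opposite signs and the residues cancel up to such an error. The error contributes
  \<open>corr\<close>.\<close>

lemma pair_cross_eq:
  assumes "\<not> 4 dvd u + v" "\<not> 4 dvd u - v"
  shows "2 * pair_cross u v =
    (if \<bar>v\<bar> < \<bar>u\<bar> then \<bar>u\<bar> + corr u v
     else \<bar>v\<bar> - 2 * sgn v + corr v u)"
proof -
  define i r where "i = u div 4" and "r = u mod 4"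
  define j s where "j = v div 4" and "s = v mod 4"
  have u: "u = 4 * i + r" and v: "v = 4 * j + s"
    by (simp_all add: i_def r_def j_def s_def)
  have rs: "u mod 4 = r" "v mod 4 = s" by (simp_all add: r_def s_def)
  have "v - u = (s - r) + (j - i) * 4" "v + u = (s + r) + (j + i) * 4"
    by (simp_all add: u v)
  then have d: "(v - u) div 4 = (j - i) + (s - r) div 4" "(v + u) div 4 = (j + i) + (s + r) div 4"
    by (simp_all only: div_mult_self1 zero_neq_numeral not_False_eq_True)
  have "r \<in> {0,1,2,3}" "s \<in> {0,1,2,3}"
    unfolding r_def s_def by auto
  moreover have "\<not> 4 dvd r + s" "\<not> 4 dvd r - s"
    using assms unfolding u v by presburger+
  \<comment> \<open>Ten of the sixteen residue pairs remain; for each the claim is piecewise linear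
    in \<open>i\<close> and \<open>j\<close>.\<close>
  ultimately consider "r = 0" "s = 1" | "r = 0" "s = 2" | "r = 0" "s = 3" | "r = 1" "s = 0"
    | "r = 1" "s = 2" | "r = 2" "s = 0" | "r = 2" "s = 1" | "r = 2" "s = 3" | "r = 3" "s = 0"
    | "r = 3" "s = 2"
    by auto
  then show ?thesis
    unfolding pair_cross_def corr_def rs d
    unfolding u v a_fun_def b_fun_def
    by (cases; simp; auto simp add: abs_if sgn_if split: if_splits; presburger)
qed

lemma pair_cross_cases:
  assumes "\<not> 4 dvd u + v" "\<not> 4 dvd u - v"
  shows pair_cross_gt: "\<bar>v\<bar> < \<bar>u\<bar> \<Longrightarrow>
      2 * pair_cross u v = \<bar>u\<bar> + corr u v"
    and pair_cross_lt: "\<bar>u\<bar> < \<bar>v\<bar> \<Longrightarrow>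
      2 * pair_cross u v = \<bar>v\<bar> - 2 * sgn v + corr v u"
  using pair_cross_eq[OF assms] by simp_all

text \<open>Modulo 4 the coordinates are 0, 2 and an odd residue in some order. For odd
  \<open>u\<close> the two values of \<open>b_fun\<close> are opposite; for even \<open>u\<close>
  the factor \<open>a_fun\<close> is 0. Hence in \<open>2 * walls P\<close> the two terms of the
  largest coordinate cancel, and the term of the middle one becomes -s.\<close>

lemma corr_cancel:
  assumes "\<not> 4 dvd u + v" "\<not> 4 dvd u - v" "\<not> 4 dvd v + w" "\<not> 4 dvd v - w"
    "\<not> 4 dvd w + u" "\<not> 4 dvd w - u"
  shows "corr u w = - corr u v"
proof -
  have "u mod 4 = 1 \<or> u mod 4 = 3 \<Longrightarrow> v mod 4 = 0 \<and> w mod 4 = 2 \<or> v mod 4 = 2 \<and> w mod 4 = 0"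
    using assms by presburger
  then show ?thesis
    by (auto simp: corr_def a_fun_def b_fun_def)
qed

lemma h'_sorted:
  assumes "max \<bar>x\<bar> (max \<bar>y\<bar> \<bar>z\<bar>) = \<bar>m\<bar>" "min \<bar>x\<bar> (min \<bar>y\<bar> \<bar>z\<bar>) = \<bar>k\<bar>"
    "\<bar>x\<bar> + \<bar>y\<bar> + \<bar>z\<bar> - \<bar>m\<bar> - \<bar>k\<bar> = \<bar>n\<bar>"
  shows "2 * h' (x, y, z) = real_of_int (2 * \<bar>m\<bar> + \<bar>n\<bar> - corr n m)"
  by (simp only: h'_def prod.case Let_def assms corr_def a_fun_abs b_fun_abs) (simp add: mult_ac)

text \<open>
  Since \<open>2x' + y'\<close> is the sum of \<open>max \<bar>u\<bar> \<bar>v\<bar>\<close> over the three pairs of coordinates, \<open>2h\<close> splits into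
  contributions of pairs. Each pair whose later coordinate is the larger one in absolute value
  contributes minus the sign of that coordinate to \<open>c\<close>; the cases on the sign of \<open>yz\<close> disappear.
\<close>

lemma h_eq_walls:
  assumes "inV P"
  shows "h P = real_of_int (walls P)"
proof (cases P)
  case (fields x y z)
  have V: "\<not> 4 dvd x + y" "\<not> 4 dvd x - y" "\<not> 4 dvd y + z" "\<not> 4 dvd y - z"
    "\<not> 4 dvd z + x" "\<not> 4 dvd z - x"
    using assms by (simp_all add: fields inV_def)
  then have V': "\<not> 4 dvd y + x" "\<not> 4 dvd y - x" "\<not> 4 dvd z + y" "\<not> 4 dvd z - y"
    "\<not> 4 dvd x + z" "\<not> 4 dvd x - z"
    by presburger+
  have ne: "\<bar>x\<bar> \<noteq> \<bar>y\<bar>" "\<bar>y\<bar> \<noteq> \<bar>z\<bar>" "\<bar>x\<bar> \<noteq> \<bar>z\<bar>"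
    using V by (auto simp: abs_if split: if_splits)
  note cx = corr_cancel[OF V]
  note cy = corr_cancel[OF V(3,4,5,6,1,2)]
  note cz = corr_cancel[OF V(5,6,1,2,3,4)]
  have "2 * h P = real_of_int (2 * walls P)"
  proof -
    consider "\<bar>y\<bar> < \<bar>x\<bar>" "\<bar>z\<bar> < \<bar>y\<bar>" "\<bar>z\<bar> < \<bar>x\<bar>"
      | "\<bar>z\<bar> < \<bar>x\<bar>" "\<bar>y\<bar> < \<bar>z\<bar>" "\<bar>y\<bar> < \<bar>x\<bar>"
      | "\<bar>x\<bar> < \<bar>y\<bar>" "\<bar>z\<bar> < \<bar>x\<bar>" "\<bar>z\<bar> < \<bar>y\<bar>"
      | "\<bar>z\<bar> < \<bar>y\<bar>" "\<bar>x\<bar> < \<bar>z\<bar>" "\<bar>x\<bar> < \<bar>y\<bar>"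
      | "\<bar>x\<bar> < \<bar>z\<bar>" "\<bar>y\<bar> < \<bar>x\<bar>" "\<bar>y\<bar> < \<bar>z\<bar>"
      | "\<bar>y\<bar> < \<bar>z\<bar>" "\<bar>x\<bar> < \<bar>y\<bar>" "\<bar>x\<bar> < \<bar>z\<bar>"
      using ne by (elim linorder_neqE) (use less_trans in blast)+
    then show ?thesis
    proof cases
      case 1
      have "2 * h' P = real_of_int (2 * \<bar>x\<bar> + \<bar>y\<bar> - corr y x)"
        unfolding fields by (rule h'_sorted[where k = z]) (use 1 in simp_all)
      moreover have "c_fun P = 0"
        using 1 by (simp add: fields c_fun_def)
      moreover have "2 * \<bar>x\<bar> + \<bar>y\<bar> - corr y x = 2 * walls P"
        using cx cy cz
          pair_cross_gt[OF V(1,2) 1(1)] pair_cross_gt[OF V(3,4) 1(2)] pair_cross_gt[OF V'(5,6) 1(3)]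
        unfolding fields walls.simps distrib_left by simp
      ultimately show ?thesis by (simp add: h_def)
    next
      case 2
      have "2 * h' P = real_of_int (2 * \<bar>x\<bar> + \<bar>z\<bar> - corr z x)"
        unfolding fields by (rule h'_sorted[where k = y]) (use 2 in simp_all)
      moreover have "2 * c_fun P = real_of_int (- 2 * sgn z)"
        using 2 by (simp add: fields c_fun_def)
      moreover have "2 * \<bar>x\<bar> + \<bar>z\<bar> - corr z x - 2 * sgn z = 2 * walls P"
        using cx cy cz
          pair_cross_gt[OF V'(5,6) 2(1)] pair_cross_lt[OF V(3,4) 2(2)] pair_cross_gt[OF V(1,2) 2(3)]
        unfolding fields walls.simps distrib_left by simp
      ultimately show ?thesis by (simp add: h_def)
    next
      case 3
      have "2 * h' P = real_of_int (2 * \<bar>y\<bar> + \<bar>x\<bar> - corr x y)"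
        unfolding fields by (rule h'_sorted[where k = z]) (use 3 in simp_all)
      moreover have "2 * c_fun P = real_of_int (- 2 * sgn y)"
        using 3 by (simp add: fields c_fun_def)
      moreover have "2 * \<bar>y\<bar> + \<bar>x\<bar> - corr x y - 2 * sgn y = 2 * walls P"
        using cx cy cz
          pair_cross_lt[OF V(1,2) 3(1)] pair_cross_gt[OF V'(5,6) 3(2)] pair_cross_gt[OF V(3,4) 3(3)]
        unfolding fields walls.simps distrib_left by simp
      ultimately show ?thesis by (simp add: h_def)
    next
      case 4
      have "2 * h' P = real_of_int (2 * \<bar>y\<bar> + \<bar>z\<bar> - corr z y)"
        unfolding fields by (rule h'_sorted[where k = x]) (use 4 in simp_all)
      \<comment> \<open>Here y and z are nonzero, as their absolute values exceed that of x:
        opposite signs cancel, equal signs add.\<close>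
      moreover have "2 * c_fun P = real_of_int (- 2 * sgn y - 2 * sgn z)"
        using 4 by (auto simp: fields c_fun_def sgn_if mult_le_0_iff)
      moreover have "2 * \<bar>y\<bar> + \<bar>z\<bar> - corr z y - 2 * sgn y - 2 * sgn z = 2 * walls P"
        using cx cy cz
          pair_cross_gt[OF V(3,4) 4(1)] pair_cross_lt[OF V'(5,6) 4(2)] pair_cross_lt[OF V(1,2) 4(3)]
        unfolding fields walls.simps distrib_left by simp
      ultimately show ?thesis by (simp add: h_def)
    next
      case 5
      have "2 * h' P = real_of_int (2 * \<bar>z\<bar> + \<bar>x\<bar> - corr x z)"
        unfolding fields by (rule h'_sorted[where k = y]) (use 5 in simp_all)
      moreover have "2 * c_fun P = real_of_int (- 4 * sgn z)"
        using 5 by (simp add: fields c_fun_def)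
      moreover have "2 * \<bar>z\<bar> + \<bar>x\<bar> - corr x z - 4 * sgn z = 2 * walls P"
        using cx cy cz
          pair_cross_lt[OF V'(5,6) 5(1)] pair_cross_gt[OF V(1,2) 5(2)] pair_cross_lt[OF V(3,4) 5(3)]
        unfolding fields walls.simps distrib_left by simp
      ultimately show ?thesis by (simp add: h_def)
    next
      case 6
      have "2 * h' P = real_of_int (2 * \<bar>z\<bar> + \<bar>y\<bar> - corr y z)"
        unfolding fields by (rule h'_sorted[where k = x]) (use 6 in simp_all)
      moreover have "2 * c_fun P = real_of_int (- 4 * sgn z - 2 * sgn y)"
        using 6 by (auto simp: fields c_fun_def sgn_if mult_le_0_iff)
      moreover have "2 * \<bar>z\<bar> + \<bar>y\<bar> - corr y z - 4 * sgn z - 2 * sgn y = 2 * walls P"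
        using cx cy cz
          pair_cross_lt[OF V(3,4) 6(1)] pair_cross_lt[OF V(1,2) 6(2)] pair_cross_lt[OF V'(5,6) 6(3)]
        unfolding fields walls.simps distrib_left by simp
      ultimately show ?thesis by (simp add: h_def)
    qed
  qed
  then show ?thesis by simp
qed

section \<open>The effect of an edge on the mirror count\<close>

text \<open>A step of length at most 1 passes no multiple of 4 unless it starts or ends on
  one.\<close>

lemma div4_same:
  fixes v w :: int
  assumes "\<not> 4 dvd v" "\<not> 4 dvd w" "\<bar>w - v\<bar> \<le> 1"
  shows "w div 4 = v div 4"
proof -
  have succ: "(u + 1) div 4 = u div 4" if "\<not> 4 dvd u + 1" for u :: int
    using that by presburger
  consider "w = v" | "w = v + 1" | "v = w + 1"
    using assms(3) by linarith
  then show ?thesis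
    by cases (use succ assms(1,2) in auto)
qed

lemma inV_roots:
  "inV (x, y, z) \<longleftrightarrow> \<not> 4 dvd y - x \<and> \<not> 4 dvd y + x \<and> \<not> 4 dvd z - y \<and> \<not> 4 dvd z + y \<and>
    \<not> 4 dvd z - x \<and> \<not> 4 dvd z + x"
  by (auto simp: inV_def dvd_diff_commute[of 4 x y] dvd_diff_commute[of 4 y z] add.commute)

text \<open>The forms lie in the interval from 0 to 4 at O, where the quotient is 0. The condition
  says that the step from \<open>v\<close> to \<open>w\<close> does not bring the quotient back from
  its side towards 0.\<close>

definition outward :: "int \<Rightarrow> int \<Rightarrow> bool" where
  "outward v w \<longleftrightarrow> (0 < v div 4 \<longrightarrow> v div 4 \<le> w div 4) \<and> (v div 4 < 0 \<longrightarrow> w div 4 \<le> v div 4)"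

lemma outward_same: "w div 4 = v div 4 \<Longrightarrow> outward v w"
  by (simp add: outward_def)

text \<open>Here \<open>m\<close> and \<open>m'\<close> stand for the mirror counts at the two ends
  of an edge along which only one form may change its quotient. A change of at most 2 in the form
  moves the quotient by at most 1.\<close>

lemma outward_step:
  assumes "m' - m = \<bar>w div 4\<bar> - \<bar>v div 4\<bar>" "\<bar>w - v\<bar> \<le> 2"
  shows "m' \<le> m + 1" "m \<le> m' \<Longrightarrow> outward v w"
proof -
  have "m' \<le> m + 1 \<and> (m \<le> m' \<longrightarrow> (0 < p \<longrightarrow> p \<le> q) \<and> (p < 0 \<longrightarrow> q \<le> p))"
    if "q \<le> p + 1" "p \<le> q + 1" "m' - m = \<bar>q\<bar> - \<bar>p\<bar>" for p q :: int
    using that by arith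
  moreover have "w div 4 \<le> v div 4 + 1" "v div 4 \<le> w div 4 + 1"
    using zdiv_mono1[of w "v + 4" 4] zdiv_mono1[of v "w + 4" 4] assms(2) by simp_all
  ultimately show "m' \<le> m + 1" "m \<le> m' \<Longrightarrow> outward v w"
    using assms(1) unfolding outward_def by blast+
qed

text \<open>
  An edge crosses exactly one mirror, so an edge along which \<open>walls\<close> does not decrease crosses no
  mirror towards \<open>O\<close>.
\<close>

lemma walls_step:
  assumes "inV (x, y, z)" "inV (x + a, y + b, z + c)" "a^2 + b^2 + c^2 = 2"
  shows "walls (x + a, y + b, z + c) \<le> walls (x, y, z) + 1 \<and>
    (walls (x, y, z) \<le> walls (x + a, y + b, z + c) \<longrightarrow>
      outward (y - x) (y + b - (x + a)) \<and>
      outward (y + x) (y + b + (x + a)) \<and>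
      outward (z - y) (z + c - (y + b)) \<and>
      outward (z + y) (z + c + (y + b)) \<and>
      outward (z - x) (z + c - (x + a)) \<and>
      outward (z + x) (z + c + (x + a)))"
proof -
  have abs1: "t = -1 \<or> t = 0 \<or> t = 1" if "t^2 \<le> 2" for t :: int
  proof -
    have "\<bar>t\<bar> < 2" by (rule power2_less_imp_less) (use that in auto)
    then show ?thesis by linarith
  qed
  have "a^2 \<ge> 0" "b^2 \<ge> 0" "c^2 \<ge> 0" by simp_all
  with assms(3) have "a^2 \<le> 2" "b^2 \<le> 2" "c^2 \<le> 2" by linarith+
  note abc = this[THEN abs1]
  note V = assms(1)[unfolded inV_roots] and W = assms(2)[unfolded inV_roots]
  have same1: "(y + b - (x + a)) div 4 = (y - x) div 4" if "\<bar>(y + b - (x + a)) - (y - x)\<bar> \<le> 1"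
    using div4_same[OF _ _ that] V W by blast
  have same2: "(y + b + (x + a)) div 4 = (y + x) div 4" if "\<bar>(y + b + (x + a)) - (y + x)\<bar> \<le> 1"
    using div4_same[OF _ _ that] V W by blast
  have same3: "(z + c - (y + b)) div 4 = (z - y) div 4" if "\<bar>(z + c - (y + b)) - (z - y)\<bar> \<le> 1"
    using div4_same[OF _ _ that] V W by blast
  have same4: "(z + c + (y + b)) div 4 = (z + y) div 4" if "\<bar>(z + c + (y + b)) - (z + y)\<bar> \<le> 1"
    using div4_same[OF _ _ that] V W by blast
  have same5: "(z + c - (x + a)) div 4 = (z - x) div 4" if "\<bar>(z + c - (x + a)) - (z - x)\<bar> \<le> 1"
    using div4_same[OF _ _ that] V W by blast
  have same6: "(z + c + (x + a)) div 4 = (z + x) div 4" if "\<bar>(z + c + (x + a)) - (z + x)\<bar> \<le> 1"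
    using div4_same[OF _ _ that] V W by blast
  \<comment> \<open>The edge vector is normal to one family of mirrors: that form changes by 2 in
    absolute value, the form of the same two coordinates with the other sign is constant, and the
    remaining four change by 1.\<close>
  from abc assms(3)
  consider "a = b" "a = 1 \<or> a = -1" "c = 0" | "a = - b" "a = 1 \<or> a = -1" "c = 0"
    | "b = c" "b = 1 \<or> b = -1" "a = 0" | "b = - c" "b = 1 \<or> b = -1" "a = 0"
    | "a = c" "a = 1 \<or> a = -1" "b = 0" | "a = - c" "a = 1 \<or> a = -1" "b = 0"
    by (elim disjE) simp_all
  then show ?thesis
  proof cases
    case 1
    then have s: "(y + b - (x + a)) div 4 = (y - x) div 4"
      "(z + c - (y + b)) div 4 = (z - y) div 4"
      "(z + c + (y + b)) div 4 = (z + y) div 4"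
      "(z + c - (x + a)) div 4 = (z - x) div 4"
      "(z + c + (x + a)) div 4 = (z + x) div 4"
      by (intro same1 same3 same4 same5 same6; auto)+
    then have d: "walls (x + a, y + b, z + c) - walls (x, y, z) =
        \<bar>(y + b + (x + a)) div 4\<bar> - \<bar>(y + x) div 4\<bar>"
      by (simp only: walls.simps pair_cross_def)
    have "\<bar>(y + b + (x + a)) - (y + x)\<bar> \<le> 2"
      using 1 by auto
    from outward_step[OF d this] s[THEN outward_same] show ?thesis
      by blast
  next
    case 2
    then have s: "(y + b + (x + a)) div 4 = (y + x) div 4"
      "(z + c - (y + b)) div 4 = (z - y) div 4"
      "(z + c + (y + b)) div 4 = (z + y) div 4"
      "(z + c - (x + a)) div 4 = (z - x) div 4"
      "(z + c + (x + a)) div 4 = (z + x) div 4"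
      by (intro same2 same3 same4 same5 same6; auto)+
    then have d: "walls (x + a, y + b, z + c) - walls (x, y, z) =
        \<bar>(y + b - (x + a)) div 4\<bar> - \<bar>(y - x) div 4\<bar>"
      by (simp only: walls.simps pair_cross_def)
    have "\<bar>(y + b - (x + a)) - (y - x)\<bar> \<le> 2"
      using 2 by auto
    from outward_step[OF d this] s[THEN outward_same] show ?thesis
      by blast
  next
    case 3
    then have s: "(y + b - (x + a)) div 4 = (y - x) div 4"
      "(y + b + (x + a)) div 4 = (y + x) div 4"
      "(z + c - (y + b)) div 4 = (z - y) div 4"
      "(z + c - (x + a)) div 4 = (z - x) div 4"
      "(z + c + (x + a)) div 4 = (z + x) div 4"
      by (intro same1 same2 same3 same5 same6; auto)+
    then have d: "walls (x + a, y + b, z + c) - walls (x, y, z) =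
        \<bar>(z + c + (y + b)) div 4\<bar> - \<bar>(z + y) div 4\<bar>"
      by (simp only: walls.simps pair_cross_def)
    have "\<bar>(z + c + (y + b)) - (z + y)\<bar> \<le> 2"
      using 3 by auto
    from outward_step[OF d this] s[THEN outward_same] show ?thesis
      by blast
  next
    case 4
    then have s: "(y + b - (x + a)) div 4 = (y - x) div 4"
      "(y + b + (x + a)) div 4 = (y + x) div 4"
      "(z + c + (y + b)) div 4 = (z + y) div 4"
      "(z + c - (x + a)) div 4 = (z - x) div 4"
      "(z + c + (x + a)) div 4 = (z + x) div 4"
      by (intro same1 same2 same4 same5 same6; auto)+
    then have d: "walls (x + a, y + b, z + c) - walls (x, y, z) =
        \<bar>(z + c - (y + b)) div 4\<bar> - \<bar>(z - y) div 4\<bar>"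
      by (simp only: walls.simps pair_cross_def)
    have "\<bar>(z + c - (y + b)) - (z - y)\<bar> \<le> 2"
      using 4 by auto
    from outward_step[OF d this] s[THEN outward_same] show ?thesis
      by blast
  next
    case 5
    then have s: "(y + b - (x + a)) div 4 = (y - x) div 4"
      "(y + b + (x + a)) div 4 = (y + x) div 4"
      "(z + c - (y + b)) div 4 = (z - y) div 4"
      "(z + c + (y + b)) div 4 = (z + y) div 4"
      "(z + c - (x + a)) div 4 = (z - x) div 4"
      by (intro same1 same2 same3 same4 same5; auto)+
    then have d: "walls (x + a, y + b, z + c) - walls (x, y, z) =
        \<bar>(z + c + (x + a)) div 4\<bar> - \<bar>(z + x) div 4\<bar>"
      by (simp only: walls.simps pair_cross_def)
    have "\<bar>(z + c + (x + a)) - (z + x)\<bar> \<le> 2"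
      using 5 by auto
    from outward_step[OF d this] s[THEN outward_same] show ?thesis
      by blast
  next
    case 6
    then have s: "(y + b - (x + a)) div 4 = (y - x) div 4"
      "(y + b + (x + a)) div 4 = (y + x) div 4"
      "(z + c - (y + b)) div 4 = (z - y) div 4"
      "(z + c + (y + b)) div 4 = (z + y) div 4"
      "(z + c + (x + a)) div 4 = (z + x) div 4"
      by (intro same1 same2 same3 same4 same6; auto)+
    then have d: "walls (x + a, y + b, z + c) - walls (x, y, z) =
        \<bar>(z + c - (x + a)) div 4\<bar> - \<bar>(z - x) div 4\<bar>"
      by (simp only: walls.simps pair_cross_def)
    have "\<bar>(z + c - (x + a)) - (z - x)\<bar> \<le> 2"
      using 6 by auto
    from outward_step[OF d this] s[THEN outward_same] show ?thesis
      by blast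
  qed
qed

section \<open>Descent towards O\<close>

text \<open>Twelve triples modulo 4 occur in V; adding 2 to every coordinate preserves the residues
  of all six forms, which leaves six classes. The first is that of O.\<close>

lemma inV_residues:
  assumes "inV (x, y, z)"
  shows "((y - x) mod 4, (y + x) mod 4, (z - y) mod 4, (z + y) mod 4, (z - x) mod 4, (z + x) mod 4)
    \<in> {(1, 1, 1, 3, 2, 2), (3, 1, 2, 2, 1, 3), (1, 3, 2, 2, 3, 1),
      (3, 3, 3, 1, 2, 2), (2, 2, 3, 3, 1, 1), (2, 2, 1, 1, 3, 3)}"
proof -
  let ?R = "{0, 1, 2, 3 :: int}"
  have *: "\<forall>i\<in>?R. \<forall>j\<in>?R. \<forall>k\<in>?R.
    (j - i) mod 4 \<noteq> 0 \<and> (j + i) mod 4 \<noteq> 0 \<and> (k - j) mod 4 \<noteq> 0 \<and> (k + j) mod 4 \<noteq> 0 \<and> (k - i) mod 4 \<noteq> 0 \<and> (k + i) mod 4 \<noteq> 0 \<longrightarrow>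
    ((j - i) mod 4, (j + i) mod 4, (k - j) mod 4, (k + j) mod 4, (k - i) mod 4, (k + i) mod 4)
    \<in> {(1, 1, 1, 3, 2, 2), (3, 1, 2, 2, 1, 3), (1, 3, 2, 2, 3, 1),
      (3, 3, 3, 1, 2, 2), (2, 2, 3, 3, 1, 1), (2, 2, 1, 1, 3, 3)}"
    by simp
  have "x mod 4 \<in> ?R" "y mod 4 \<in> ?R" "z mod 4 \<in> ?R"
    by auto
  from *[THEN bspec, OF this(1), THEN bspec, OF this(2), THEN bspec, OF this(3)] assms
  show ?thesis
    unfolding inV_roots dvd_eq_mod_eq_0 mod_diff_eq mod_add_eq by (rule mp)
qed

text \<open>
  If no neighbour of a vertex is separated from \<open>O\<close> by fewer mirrors, then \<open>O\<close> lies on the same side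
  as the vertex of all four walls of its alcove, hence in that alcove.
\<close>

lemma walls_descent:
  assumes "inV (x, y, z)" "(x, y, z) \<noteq> O_pt"
  shows "\<exists>Q. adjG (x, y, z) Q \<and> walls Q < walls (x, y, z)"
proof (rule ccontr)
  assume "\<not> ?thesis"
  then have nd: "walls (x, y, z) \<le> walls Q" if "adjG (x, y, z) Q" for Q
    using that by (meson not_le)
  \<comment> \<open>The residue conditions say that the shifted point is again in V, hence a
    neighbour, along which the count does not decrease by \<open>nd\<close>.\<close>
  have up: "outward (y - x) (y - x + (b - a)) \<and> outward (y + x) (y + x + (b + a)) \<and>
      outward (z - y) (z - y + (c - b)) \<and> outward (z + y) (z + y + (c + b)) \<and>
      outward (z - x) (z - x + (c - a)) \<and> outward (z + x) (z + x + (c + a))"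
    if sq: "a^2 + b^2 + c^2 = 2"
      and res: "((y - x) mod 4 + (b - a)) mod 4 \<noteq> 0" "((y + x) mod 4 + (b + a)) mod 4 \<noteq> 0"
      "((z - y) mod 4 + (c - b)) mod 4 \<noteq> 0" "((z + y) mod 4 + (c + b)) mod 4 \<noteq> 0"
      "((z - x) mod 4 + (c - a)) mod 4 \<noteq> 0" "((z + x) mod 4 + (c + a)) mod 4 \<noteq> 0" for a b c
  proof -
    have shift: "y + b - (x + a) = y - x + (b - a)" "y + b + (x + a) = y + x + (b + a)"
      "z + c - (y + b) = z - y + (c - b)" "z + c + (y + b) = z + y + (c + b)"
      "z + c - (x + a) = z - x + (c - a)" "z + c + (x + a) = z + x + (c + a)"
      by simp_all
    have "inV (x + a, y + b, z + c)"
      using res unfolding inV_roots dvd_eq_mod_eq_0 mod_add_left_eq shift by (intro conjI)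
    from walls_step[OF assms(1) this sq] nd[of "(x + a, y + b, z + c)"] this show ?thesis
      unfolding shift using assms(1) sq by (simp add: adjG_def sqdist_def)
  qed
  \<comment> \<open>With residue 1, lowering the form by 2 crosses the multiple of 4 just below; if
    that is not a move towards O, the quotient is at most 0. \<open>high\<close> is the mirror
    image.\<close>
  have low: "v \<le> 1" if "outward v (v - 2)" "v mod 4 = 1" for v
    using that unfolding outward_def by presburger
  have high: "3 \<le> v" if "outward v (v + 2)" "v mod 4 = 3" for v
    using that unfolding outward_def by presburger
  \<comment> \<open>In each class the four forms with odd residue give the walls of the alcove.
    Reflecting the vertex in such a wall lowers the form by 2 at residue 1 and raises it by 2 at
    residue 3; this determines the vectors passed to \<open>up\<close>.\<close>
  from inV_residues[OF assms(1)] consider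
      "(y - x) mod 4 = 1" "(y + x) mod 4 = 1"
      "(z - y) mod 4 = 1" "(z + y) mod 4 = 3" "(z - x) mod 4 = 2" "(z + x) mod 4 = 2"
    | "(y - x) mod 4 = 3" "(y + x) mod 4 = 1"
      "(z - y) mod 4 = 2" "(z + y) mod 4 = 2" "(z - x) mod 4 = 1" "(z + x) mod 4 = 3"
    | "(y - x) mod 4 = 1" "(y + x) mod 4 = 3"
      "(z - y) mod 4 = 2" "(z + y) mod 4 = 2" "(z - x) mod 4 = 3" "(z + x) mod 4 = 1"
    | "(y - x) mod 4 = 3" "(y + x) mod 4 = 3"
      "(z - y) mod 4 = 3" "(z + y) mod 4 = 1" "(z - x) mod 4 = 2" "(z + x) mod 4 = 2"
    | "(y - x) mod 4 = 2" "(y + x) mod 4 = 2"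
      "(z - y) mod 4 = 3" "(z + y) mod 4 = 3" "(z - x) mod 4 = 1" "(z + x) mod 4 = 1"
    | "(y - x) mod 4 = 2" "(y + x) mod 4 = 2"
      "(z - y) mod 4 = 1" "(z + y) mod 4 = 1" "(z - x) mod 4 = 3" "(z + x) mod 4 = 3"
    by (elim insertE emptyE; simp only: prod.inject simp_thms)
  then show False
  proof cases
    case 1
    have "outward (y - x) (y - x - 2)"
      using up[of 1 "- 1" 0] by (simp add: 1)
    from low[OF this 1(1)] have a: "y - x \<le> 1" .
    have "outward (y + x) (y + x - 2)"
      using up[of "- 1" "- 1" 0] by (simp add: 1)
    from low[OF this 1(2)] have b: "y + x \<le> 1" .
    have "outward (z + y) (z + y + 2)"
      using up[of 0 1 1] by (simp add: 1)
    from high[OF this 1(4)] have c: "3 \<le> z + y" .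
    have "outward (z - y) (z - y - 2)"
      using up[of 0 1 "- 1"] by (simp add: 1)
    from low[OF this 1(3)] have d: "z - y \<le> 1" .
    \<comment> \<open>The four bounds force y = 1, z = 2 and x = 0.\<close>
    show False using a b c d assms(2) by (simp add: O_pt_def)
  next
    case 2
    have "outward (y - x) (y - x + 2)"
      using up[of "- 1" 1 0] by (simp add: 2)
    from high[OF this 2(1)] have a: "3 \<le> y - x" .
    have "outward (y + x) (y + x - 2)"
      using up[of "- 1" "- 1" 0] by (simp add: 2)
    from low[OF this 2(2)] have b: "y + x \<le> 1" .
    have "outward (z + x) (z + x + 2)"
      using up[of 1 0 1] by (simp add: 2)
    from high[OF this 2(6)] have c: "3 \<le> z + x" .
    have "outward (z - x) (z - x - 2)"
      using up[of 1 0 "- 1"] by (simp add: 2)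
    from low[OF this 2(5)] have d: "z - x \<le> 1" .
    \<comment> \<open>The bounds give both x <= -1 and x >= 1. In the other classes, too, they
      contradict each other in a single coordinate.\<close>
    show False using a b c d by linarith
  next
    case 3
    have "outward (z - x) (z - x + 2)"
      using up[of "- 1" 0 1] by (simp add: 3)
    from high[OF this 3(5)] have a: "3 \<le> z - x" .
    have "outward (z + x) (z + x - 2)"
      using up[of "- 1" 0 "- 1"] by (simp add: 3)
    from low[OF this 3(6)] have b: "z + x \<le> 1" .
    have "outward (y + x) (y + x + 2)"
      using up[of 1 1 0] by (simp add: 3)
    from high[OF this 3(2)] have c: "3 \<le> y + x" .
    have "outward (y - x) (y - x - 2)"
      using up[of 1 "- 1" 0] by (simp add: 3)
    from low[OF this 3(1)] have d: "y - x \<le> 1" .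
    show False using a b c d by linarith
  next
    case 4
    have "outward (z - y) (z - y + 2)"
      using up[of 0 "- 1" 1] by (simp add: 4)
    from high[OF this 4(3)] have a: "3 \<le> z - y" .
    have "outward (z + y) (z + y - 2)"
      using up[of 0 "- 1" "- 1"] by (simp add: 4)
    from low[OF this 4(4)] have b: "z + y \<le> 1" .
    have "outward (y + x) (y + x + 2)"
      using up[of 1 1 0] by (simp add: 4)
    from high[OF this 4(2)] have c: "3 \<le> y + x" .
    have "outward (y - x) (y - x + 2)"
      using up[of "- 1" 1 0] by (simp add: 4)
    from high[OF this 4(1)] have d: "3 \<le> y - x" .
    show False using a b c d by linarith
  next
    case 5
    have "outward (z - x) (z - x - 2)"
      using up[of 1 0 "- 1"] by (simp add: 5)
    from low[OF this 5(5)] have a: "z - x \<le> 1" .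
    have "outward (z + x) (z + x - 2)"
      using up[of "- 1" 0 "- 1"] by (simp add: 5)
    from low[OF this 5(6)] have b: "z + x \<le> 1" .
    have "outward (z + y) (z + y + 2)"
      using up[of 0 1 1] by (simp add: 5)
    from high[OF this 5(4)] have c: "3 \<le> z + y" .
    have "outward (z - y) (z - y + 2)"
      using up[of 0 "- 1" 1] by (simp add: 5)
    from high[OF this 5(3)] have d: "3 \<le> z - y" .
    show False using a b c d by linarith
  next
    case 6
    have "outward (z - y) (z - y - 2)"
      using up[of 0 1 "- 1"] by (simp add: 6)
    from low[OF this 6(3)] have a: "z - y \<le> 1" .
    have "outward (z + y) (z + y - 2)"
      using up[of 0 "- 1" "- 1"] by (simp add: 6)
    from low[OF this 6(4)] have b: "z + y \<le> 1" .
    have "outward (z + x) (z + x + 2)"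
      using up[of 1 0 1] by (simp add: 6)
    from high[OF this 6(6)] have c: "3 \<le> z + x" .
    have "outward (z - x) (z - x + 2)"
      using up[of "- 1" 0 1] by (simp add: 6)
    from high[OF this 6(5)] have d: "3 \<le> z - x" .
    show False using a b c d by linarith
  qed
qed

section \<open>Mirror count and graph distance\<close>

lemma adjG_sym: "adjG P Q \<Longrightarrow> adjG Q P"
  by (cases P; cases Q) (simp add: adjG_def sqdist_def power2_commute)

lemma walls_adj:
  assumes "adjG P Q"
  shows "walls Q \<le> walls P + 1"
proof (cases P, cases Q)
  fix x y z x' y' z'
  assume PQ: "P = (x, y, z)" "Q = (x', y', z')"
  show ?thesis
    using walls_step[of x y z "x' - x" "y' - y" "z' - z"] assms
    by (simp add: PQ adjG_def sqdist_def power2_commute)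
qed

lemma walls_nonneg: "0 \<le> walls P"
  by (cases P) (simp add: pair_cross_def)

lemma walls_O: "walls O_pt = 0"
  by (simp add: O_pt_def pair_cross_def)

lemma walls_le_length:
  assumes "(adjG ^^ n) O_pt P"
  shows "walls P \<le> int n"
  using assms
proof (induction n arbitrary: P)
  case 0
  then show ?case by (simp add: walls_O)
next
  case (Suc n)
  then obtain Q where "(adjG ^^ n) O_pt Q" "adjG Q P" by auto
  then show ?case using Suc.IH[of Q] walls_adj[of Q P] by simp
qed

text \<open>Since an edge changes the count by at most 1 in either direction, each descent step
  lowers it by exactly 1; the descent from \<open>P\<close> to O, read backwards, is the
  walk.\<close>

lemma walk_of_walls_length:
  assumes "inV P"
  shows "(adjG ^^ nat (walls P)) O_pt P"
  using assms
proof (induction "nat (walls P)" arbitrary: P rule: less_induct)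
  case less
  show ?case
  proof (cases "P = O_pt")
    case True
    then show ?thesis by (simp add: walls_O)
  next
    case False
    then obtain Q where Q: "adjG P Q" "walls Q < walls P"
      using walls_descent less.prems by (cases P) blast
    then have "nat (walls P) = Suc (nat (walls Q))"
      using walls_adj[OF adjG_sym[OF Q(1)]] walls_nonneg[of Q] by linarith
    moreover have "(adjG ^^ nat (walls Q)) O_pt Q"
      using less.hyps[of Q] Q calculation by (simp add: adjG_def)
    ultimately show ?thesis using adjG_sym[OF Q(1)] by auto
  qed
qed

theorem theorem1:
  fixes P :: pt
  assumes "inV P"
  shows "\<exists>n :: nat. dis P = enat n \<and> real n = h P"
proof (intro exI conjI)
  show "dis P = enat (nat (walls P))"
    unfolding dis_def
  proof (rule antisym)
    show "(INF n \<in> {n. (adjG ^^ n) O_pt P}. enat n) \<le> enat (nat (walls P))"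
      by (rule INF_lower) (simp add: walk_of_walls_length[OF assms])
    show "enat (nat (walls P)) \<le> (INF n \<in> {n. (adjG ^^ n) O_pt P}. enat n)"
      by (rule INF_greatest) (use walls_le_length[of _ P] in \<open>auto simp: nat_le_iff\<close>)
  qed
  show "real (nat (walls P)) = h P"
    using h_eq_walls[OF assms] walls_nonneg[of P] by simp
qed

end
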